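(* For $n\ge 1$ let $a_n = |S_n^2(213,231,321)|$. Then $a_1=1$ and $a_{n+1} = 2(n+1)$ for all $n\ge 1$.
   Context: A $3$-permutation of size $n$ is an ordered pair $(\sigma,\sigma')$ of permutations of $[n]=\{1,\dots,n\}$. A (classical) permutation $\tau\in S_n$ contains a pattern $\pi\in S_k$ if there are indices $c_1<\dots<c_k$ such that $\tau(c_1)\cdots\tau(c_k)$ is order-isomorphic to $\pi$, and avoids $\pi$ otherwise. A $3$-permutation $(\sigma,\sigma')$ avoids a pattern $\pi\in S_k$ if each of the three permutations $\sigma$, $\sigma'$, and $\sigma'\circ\sigma^{-1}$ (where $(\sigma'\circ\sigma^{-1})(i)=\sigma'(\sigma^{-1}(i))$) avoids $\pi$. $S_n^2(\pi_1,\dots,\pi_m)$ denotes the set of $3$-permutations of size $n$ avoiding each of $\pi_1,\dots,\pi_m$. Patterns are written in one-line notation. *)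

theory Defs
  imports "HOL-Combinatorics.Permutations"
begin

text \<open>
  A permutation of \<open>[n] = {1, ..., n}\<close> is a function that \<open>permutes {1..n}\<close> (and so is the
  identity outside \<open>{1..n}\<close>). A pattern of size \<open>k\<close> is given by its one-line notation, a word
  of length \<open>k\<close> over \<open>nat\<close>; e.g. \<open>[2, 1, 3]\<close> is the pattern 213. List positions, and hence
  the index sequence \<open>c\<close> below, count from 0.
\<close>

definition contains_pattern :: "nat \<Rightarrow> (nat \<Rightarrow> nat) \<Rightarrow> nat list \<Rightarrow> bool" where
  "contains_pattern n \<tau> \<pi> \<longleftrightarrow>
     (\<exists>c :: nat \<Rightarrow> nat.
        strict_mono_on {..<length \<pi>} c \<and>
        c ` {..<length \<pi>} \<subseteq> {1..n} \<and>
        (\<forall>i < length \<pi>. \<forall>j < length \<pi>. \<tau> (c i) < \<tau> (c j) \<longleftrightarrow> \<pi> ! i < \<pi> ! j))"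

definition avoids_pattern :: "nat \<Rightarrow> (nat \<Rightarrow> nat) \<Rightarrow> nat list \<Rightarrow> bool" where
  "avoids_pattern n \<tau> \<pi> \<longleftrightarrow> \<not> contains_pattern n \<tau> \<pi>"

definition three_permutations :: "nat \<Rightarrow> ((nat \<Rightarrow> nat) \<times> (nat \<Rightarrow> nat)) set" where
  "three_permutations n = {(\<sigma>, \<sigma>'). \<sigma> permutes {1..n} \<and> \<sigma>' permutes {1..n}}"

fun three_avoids_pattern :: "nat \<Rightarrow> (nat \<Rightarrow> nat) \<times> (nat \<Rightarrow> nat) \<Rightarrow> nat list \<Rightarrow> bool" where
  "three_avoids_pattern n (\<sigma>, \<sigma>') \<pi> \<longleftrightarrow>
     avoids_pattern n \<sigma> \<pi> \<and> avoids_pattern n \<sigma>' \<pi> \<and> avoids_pattern n (\<sigma>' \<circ> inv \<sigma>) \<pi>"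

definition avoiding_three_permutations ::
    "nat \<Rightarrow> nat list set \<Rightarrow> ((nat \<Rightarrow> nat) \<times> (nat \<Rightarrow> nat)) set" where
  "avoiding_three_permutations n P =
     {p \<in> three_permutations n. \<forall>\<pi> \<in> P. three_avoids_pattern n p \<pi>}"

end

theory Submission
  imports Defs
begin

text \<open>
  Avoiding 213 and 231 forces every entry to be the minimum or the maximum of the entries from it
  onwards, and avoiding 321 then forces everything after \<open>n\<close> to increase. So the permutations
  avoiding the three patterns are the \<open>n\<close> words \<open>1, \<dots>, k-1, n, k, \<dots>, n-1\<close>; call them
  \<open>s\<^sub>k\<close> (\<open>shift n k\<close> below). Their last value is \<open>n-1\<close> or \<open>n\<close>, whereas that of
  \<open>s\<^sub>k \<circ> s\<^sub>j\<^sup>-\<^sup>1\<close> is \<open>s\<^sub>k(j)\<close>. Hence \<open>j = k\<close>, or \<open>j = n\<close>, or \<open>(j, k) = (n-1, n)\<close>, and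
  for \<open>n \<ge> 2\<close> all of these \<open>n + (n-1) + 1\<close> pairs qualify.
\<close>

section \<open>Patterns of length three as inequalities\<close>

lemma contains_pattern_3:
  "contains_pattern n \<tau> [x, y, z] \<longleftrightarrow>
     (\<exists>a b c. 1 \<le> a \<and> a < b \<and> b < c \<and> c \<le> n \<and>
        (\<tau> a < \<tau> b \<longleftrightarrow> x < y) \<and> (\<tau> b < \<tau> a \<longleftrightarrow> y < x) \<and>
        (\<tau> a < \<tau> c \<longleftrightarrow> x < z) \<and> (\<tau> c < \<tau> a \<longleftrightarrow> z < x) \<and>
        (\<tau> b < \<tau> c \<longleftrightarrow> y < z) \<and> (\<tau> c < \<tau> b \<longleftrightarrow> z < y))" (is "_ \<longleftrightarrow> ?R")
proof -
  have lt3: "{..<length [x, y, z]} = {0, 1, 2}" by auto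
  have all3: "(\<forall>i<length [x, y, z]. P i) \<longleftrightarrow> P 0 \<and> P 1 \<and> P 2" for P
    by (auto simp: less_Suc_eq numeral_2_eq_2)
  show ?thesis
  proof
    assume "contains_pattern n \<tau> [x, y, z]"
    then obtain c where mono: "strict_mono_on {0, 1, 2} c" and ran: "c ` {0, 1, 2} \<subseteq> {1..n}"
      and iso: "\<forall>i<length [x, y, z]. \<forall>j<length [x, y, z].
        \<tau> (c i) < \<tau> (c j) \<longleftrightarrow> [x, y, z] ! i < [x, y, z] ! j"
      unfolding contains_pattern_def lt3 by blast
    have "c 0 < c 1" "c 1 < c 2"
      by (rule strict_mono_onD[OF mono]; simp)+
    moreover have "1 \<le> c 0" "c 2 \<le> n" using ran by auto
    ultimately show ?R
      using iso unfolding all3 by (intro exI[of _ "c 0"] exI[of _ "c 1"] exI[of _ "c 2"]) simp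
  next
    assume ?R
    then obtain a b c where "1 \<le> a" "a < b" "b < c" "c \<le> n"
        and "\<tau> a < \<tau> b \<longleftrightarrow> x < y" "\<tau> b < \<tau> a \<longleftrightarrow> y < x"
        "\<tau> a < \<tau> c \<longleftrightarrow> x < z" "\<tau> c < \<tau> a \<longleftrightarrow> z < x"
        "\<tau> b < \<tau> c \<longleftrightarrow> y < z" "\<tau> c < \<tau> b \<longleftrightarrow> z < y"
      by blast
    then show "contains_pattern n \<tau> [x, y, z]"
      unfolding contains_pattern_def lt3 all3
      by (intro exI[of _ "\<lambda>i. [a, b, c] ! i"]) (auto simp: strict_mono_on_def)
  qed
qed

definition avoids_all :: "nat \<Rightarrow> (nat \<Rightarrow> nat) \<Rightarrow> bool" where
  "avoids_all n \<tau> \<longleftrightarrow>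
     avoids_pattern n \<tau> [2, 1, 3] \<and> avoids_pattern n \<tau> [2, 3, 1] \<and> avoids_pattern n \<tau> [3, 2, 1]"

text \<open>A chain of two strict inequalities already settles all six comparisons of a pattern of
  length three, so one chain per pattern is enough.\<close>

lemma avoids_all_iff:
  "avoids_all n \<tau> \<longleftrightarrow> (\<forall>a b c. 1 \<le> a \<longrightarrow> a < b \<longrightarrow> b < c \<longrightarrow> c \<le> n \<longrightarrow>
     \<not> (\<tau> b < \<tau> a \<and> \<tau> a < \<tau> c) \<and> \<not> (\<tau> c < \<tau> a \<and> \<tau> a < \<tau> b) \<and> \<not> (\<tau> c < \<tau> b \<and> \<tau> b < \<tau> a))"
  (is "_ \<longleftrightarrow> ?R")
proof
  assume *: "avoids_all n \<tau>"
  show ?R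
  proof (intro allI impI)
    fix a b c assume abc: "1 \<le> a" "a < b" "b < c" "c \<le> n"
    have "\<not> (\<tau> b < \<tau> a \<and> \<tau> a < \<tau> c)"
    proof
      assume "\<tau> b < \<tau> a \<and> \<tau> a < \<tau> c"
      then have "contains_pattern n \<tau> [2, 1, 3]" unfolding contains_pattern_3
        using abc by (intro exI[of _ a] exI[of _ b] exI[of _ c]) simp
      then show False using * unfolding avoids_all_def avoids_pattern_def by blast
    qed
    moreover have "\<not> (\<tau> c < \<tau> a \<and> \<tau> a < \<tau> b)"
    proof
      assume "\<tau> c < \<tau> a \<and> \<tau> a < \<tau> b"
      then have "contains_pattern n \<tau> [2, 3, 1]" unfolding contains_pattern_3
        using abc by (intro exI[of _ a] exI[of _ b] exI[of _ c]) simp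
      then show False using * unfolding avoids_all_def avoids_pattern_def by blast
    qed
    moreover have "\<not> (\<tau> c < \<tau> b \<and> \<tau> b < \<tau> a)"
    proof
      assume "\<tau> c < \<tau> b \<and> \<tau> b < \<tau> a"
      then have "contains_pattern n \<tau> [3, 2, 1]" unfolding contains_pattern_3
        using abc by (intro exI[of _ a] exI[of _ b] exI[of _ c]) simp
      then show False using * unfolding avoids_all_def avoids_pattern_def by blast
    qed
    ultimately show "\<not> (\<tau> b < \<tau> a \<and> \<tau> a < \<tau> c) \<and> \<not> (\<tau> c < \<tau> a \<and> \<tau> a < \<tau> b) \<and>
        \<not> (\<tau> c < \<tau> b \<and> \<tau> b < \<tau> a)" by blast
  qed
next
  assume ?R
  then have R: "\<not> (\<tau> b < \<tau> a \<and> \<tau> a < \<tau> c) \<and> \<not> (\<tau> c < \<tau> a \<and> \<tau> a < \<tau> b) \<and>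
      \<not> (\<tau> c < \<tau> b \<and> \<tau> b < \<tau> a)" if "1 \<le> a" "a < b" "b < c" "c \<le> n" for a b c
    using that by blast
  show "avoids_all n \<tau>"
    unfolding avoids_all_def avoids_pattern_def contains_pattern_3
    by (intro conjI notI; elim exE conjE; drule (3) R; simp)
qed

section \<open>The candidate permutations and their inverses\<close>

definition shift :: "nat \<Rightarrow> nat \<Rightarrow> nat \<Rightarrow> nat" where
  "shift n k i = (if i < k \<or> n < i then i else if i = k then n else i - 1)"

text \<open>The inverse cycle, sending k to k + 1 and so on up to n, and n back to k. Having it in
  closed form lets compositions with \<open>inv (shift n k)\<close> be computed by cases.\<close>

definition unshift :: "nat \<Rightarrow> nat \<Rightarrow> nat \<Rightarrow> nat" where
  "unshift n k i = (if i < k \<or> n < i then i else if i = n then k else i + 1)"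

lemma inv_shift: "k \<in> {1..n} \<Longrightarrow> inv (shift n k) = unshift n k"
  by (rule inv_unique_comp) (auto simp: fun_eq_iff shift_def unshift_def)

lemma shift_permutes:
  assumes "k \<in> {1..n}"
  shows "shift n k permutes {1..n}"
  unfolding permutes_def
proof (intro conjI allI impI)
  fix x assume "x \<notin> {1..n}"
  then show "shift n k x = x" using assms by (auto simp: shift_def)
next
  fix y
  have "shift n k (unshift n k y) = y" "\<And>x. unshift n k (shift n k x) = x"
    using assms by (auto simp: shift_def unshift_def)
  then show "\<exists>!x. shift n k x = y" by metis
qed

text \<open>Every inversion of \<open>shift n k\<close> has n as its larger entry. In each of the
  three patterns, however, 2 precedes 1, which is an inversion whose larger entry is not the
  maximum.\<close>

lemma shift_avoids_all: "k \<in> {1..n} \<Longrightarrow> avoids_all n (shift n k)"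
  unfolding avoids_all_iff by (auto simp: shift_def)

lemma shift_self: "shift n n = id"
  by (auto simp: shift_def fun_eq_iff)

lemma shift_eq_iff:
  assumes "j \<in> {1..n}" "k \<in> {1..n}"
  shows "shift n j = shift n k \<longleftrightarrow> j = k"
proof
  assume "shift n j = shift n k"
  \<comment> \<open>The right-hand side is n, a value that \<open>shift n j\<close> takes only at
    j.\<close>
  then have "shift n j k = shift n k k" by simp
  then show "j = k" using assms by (auto simp: shift_def split: if_splits)
qed simp

section \<open>Classification of the avoiding permutations\<close>

lemma permutes_value_eq_card:
  fixes f :: "nat \<Rightarrow> nat"
  assumes f: "f permutes {1..n}" and a: "a \<in> {1..n}"
  shows "f a = card {b \<in> {1..n}. f b \<le> f a}"
proof -
  have "f a \<in> {1..n}" using permutes_in_image[OF f] a by blast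
  moreover have "f ` {b \<in> {1..n}. f b \<le> f a} = {y \<in> f ` {1..n}. y \<le> f a}" by blast
  ultimately have "f ` {b \<in> {1..n}. f b \<le> f a} = {1..f a}"
    unfolding permutes_image[OF f] by auto
  moreover have "inj_on f {b \<in> {1..n}. f b \<le> f a}"
    using permutes_inj_on[OF f] .
  ultimately show ?thesis by (metis card_image card_atLeastAtMost diff_Suc_1)
qed

text \<open>The position k of n determines everything: the entries other than n must increase, and a
  permutation is recovered from the ranks of its values.\<close>

lemma avoids_all_imp_shift:
  assumes f: "f permutes {1..n}" and av: "avoids_all n f" and n: "1 \<le> n"
  shows "\<exists>k\<in>{1..n}. f = shift n k"
proof -
  obtain k where k: "k \<in> {1..n}" "f k = n"
    using permutes_image[OF f] n by (metis atLeastAtMost_iff imageE order_refl)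
  have ran: "f a \<le> n" if "a \<in> {1..n}" for a using permutes_in_image[OF f] that by auto
  have inj: "f a = f b \<longleftrightarrow> a = b" for a b using permutes_inj[OF f] by (auto dest: injD)
  have lt: "f a < n" if "a \<in> {1..n}" "a \<noteq> k" for a
    using ran[OF that(1)] inj[of a k] k that by linarith
  have pat: "\<not> (f b < f a \<and> f a < f c) \<and> \<not> (f c < f a \<and> f a < f b) \<and> \<not> (f c < f b \<and> f b < f a)"
    if "1 \<le> a" "a < b" "b < c" "c \<le> n" for a b c
    using av that unfolding avoids_all_iff by blast
  have mono: "f a < f b" if ab: "1 \<le> a" "a < b" "b \<le> n" "a \<noteq> k" for a b
  proof (rule ccontr)
    assume "\<not> f a < f b"
    then have ba: "f b < f a" using inj[of a b] ab by linarith
    have an: "f a < n" using lt ab by auto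
    \<comment> \<open>The inversion at a < b does not involve n as its larger entry. Adding n at
      position k completes it to 321, 231 or 213 in the first three cases; in the last one f b = n
      is too large.\<close>
    consider "k < a" | "a < k" "k < b" | "b < k" | "b = k" using ab by linarith
    then show False
    proof cases
      case 1 then show False using pat[of k a b] ba an k ab by auto
    next
      case 2 then show False using pat[of a k b] ba an k ab by auto
    next
      case 3 then show False using pat[of a b k] ba an k ab by auto
    next
      case 4 then show False using ba an k by auto
    qed
  qed
  have le_iff: "f b \<le> f a \<longleftrightarrow> b \<le> a \<and> b \<noteq> k" if "a \<in> {1..n}" "b \<in> {1..n}" "a \<noteq> k" for a b
    using that mono[of a b] mono[of b a] lt[of a] k inj[of a b]
    by (cases a b rule: linorder_cases) auto
  have "f a = shift n k a" for a
  proof (cases "a \<in> {1..n} \<and> a \<noteq> k")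
    case True
    \<comment> \<open>Removing k lowers the rank by one exactly when k < a, which gives the two
      branches a and a - 1 of \<open>shift\<close>.\<close>
    then have "{b \<in> {1..n}. f b \<le> f a} = {1..a} - {k}" using le_iff by auto
    then have "f a = card ({1..a} - {k})" using permutes_value_eq_card[OF f, of a] True by simp
    also have "\<dots> = shift n k a"
      using True k by (cases "k \<le> a") (auto simp: shift_def)
    finally show ?thesis .
  next
    case False
    then show ?thesis using permutes_not_in[OF f] k by (auto simp: shift_def)
  qed
  then show ?thesis using k by blast
qed

section \<open>The third permutation\<close>

lemma shift_comp_inv_avoids_all_iff:
  assumes j: "j \<in> {1..n}" and k: "k \<in> {1..n}"
  shows "avoids_all n (shift n k \<circ> inv (shift n j)) \<longleftrightarrow> j = k \<or> j = n \<or> (j = n - 1 \<and> k = n)"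
    (is "avoids_all n ?h \<longleftrightarrow> _")
proof
  assume av: "avoids_all n ?h"
  have "?h permutes {1..n}"
    using shift_permutes[OF j] shift_permutes[OF k] by (intro permutes_compose permutes_inv)
  then obtain m where m: "m \<in> {1..n}" "?h = shift n m"
    using avoids_all_imp_shift av j by fastforce
  have "?h n = shift n k j" using j by (simp add: inv_shift[OF j] unshift_def)
  then have "shift n k j = shift n m n" using m by simp
  \<comment> \<open>The right-hand side is n if m = n, and n - 1 otherwise. The value n is taken by
    \<open>shift n k\<close> only at k; the value n - 1 comes from j = n if k < n, and from j = n -
    1 if k = n.\<close>
  then show "j = k \<or> j = n \<or> (j = n - 1 \<and> k = n)"
    using j k m(1) by (auto simp: shift_def split: if_splits)
next
  have "avoids_all n id" using shift_avoids_all[of n n] j by (simp add: shift_self)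
  moreover have "shift n k \<circ> inv (shift n k) = id"
    using permutes_inv_o[OF shift_permutes[OF k]] by simp
  \<comment> \<open>\<open>shift n (n - 1)\<close> exchanges n - 1 and n, so it is its own inverse.
    The guard excludes n = 1, where n - 1 is 0.\<close>
  moreover have "shift n n \<circ> inv (shift n (n - 1)) = shift n (n - 1)" if "n - 1 \<in> {1..n}"
    unfolding inv_shift[OF that] using that by (auto simp: shift_def unshift_def fun_eq_iff)
  moreover assume "j = k \<or> j = n \<or> (j = n - 1 \<and> k = n)"
  ultimately show "avoids_all n ?h"
    using j k shift_avoids_all by (auto simp: shift_self)
qed

text \<open>By the classification, the conditions on the first two permutations supply the indices j
  and k; the third condition then restricts the pair of indices.\<close>

lemma avoiding_three_permutations_eq:
  assumes "1 \<le> n"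
  shows "avoiding_three_permutations n {[2, 1, 3], [2, 3, 1], [3, 2, 1]} =
    (\<lambda>(j, k). (shift n j, shift n k)) `
      {(j, k). j \<in> {1..n} \<and> k \<in> {1..n} \<and> (j = k \<or> j = n \<or> (j = n - 1 \<and> k = n))}"
    (is "?L = ?R")
proof -
  have mem: "(\<sigma>, \<sigma>') \<in> ?L \<longleftrightarrow> \<sigma> permutes {1..n} \<and> \<sigma>' permutes {1..n} \<and>
      avoids_all n \<sigma> \<and> avoids_all n \<sigma>' \<and> avoids_all n (\<sigma>' \<circ> inv \<sigma>)" for \<sigma> \<sigma>'
    unfolding avoiding_three_permutations_def three_permutations_def avoids_all_def by auto
  have shift_iff: "f permutes {1..n} \<and> avoids_all n f \<longleftrightarrow> (\<exists>k\<in>{1..n}. f = shift n k)" for f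
    using avoids_all_imp_shift[OF _ _ assms] shift_permutes shift_avoids_all by blast
  have "(\<sigma>, \<sigma>') \<in> ?L \<longleftrightarrow> (\<sigma>, \<sigma>') \<in> ?R" for \<sigma> \<sigma>'
  proof -
    have "(\<sigma>, \<sigma>') \<in> ?L \<longleftrightarrow> (\<sigma> permutes {1..n} \<and> avoids_all n \<sigma>) \<and>
        (\<sigma>' permutes {1..n} \<and> avoids_all n \<sigma>') \<and> avoids_all n (\<sigma>' \<circ> inv \<sigma>)"
      unfolding mem by argo
    also have "\<dots> \<longleftrightarrow> (\<exists>j\<in>{1..n}. \<exists>k\<in>{1..n}. \<sigma> = shift n j \<and> \<sigma>' = shift n k \<and>
        avoids_all n (shift n k \<circ> inv (shift n j)))"
      unfolding shift_iff by auto
    also have "\<dots> \<longleftrightarrow> (\<exists>j\<in>{1..n}. \<exists>k\<in>{1..n}. \<sigma> = shift n j \<and> \<sigma>' = shift n k \<and>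
        (j = k \<or> j = n \<or> (j = n - 1 \<and> k = n)))"
      by (intro bex_cong conj_cong refl shift_comp_inv_avoids_all_iff)
    also have "\<dots> \<longleftrightarrow> (\<sigma>, \<sigma>') \<in> ?R"
    proof
      assume "\<exists>j\<in>{1..n}. \<exists>k\<in>{1..n}. \<sigma> = shift n j \<and> \<sigma>' = shift n k \<and>
        (j = k \<or> j = n \<or> (j = n - 1 \<and> k = n))"
      then obtain j k where jk: "j \<in> {1..n}" "k \<in> {1..n}" "\<sigma> = shift n j" "\<sigma>' = shift n k"
        "j = k \<or> j = n \<or> (j = n - 1 \<and> k = n)" by blast
      show "(\<sigma>, \<sigma>') \<in> ?R"
        by (rule image_eqI[of _ _ "(j, k)"]) (use jk in simp_all)
    next
      assume "(\<sigma>, \<sigma>') \<in> ?R"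
      then obtain p where "(\<sigma>, \<sigma>') = (\<lambda>(j, k). (shift n j, shift n k)) p"
        "p \<in> {(j, k). j \<in> {1..n} \<and> k \<in> {1..n} \<and> (j = k \<or> j = n \<or> (j = n - 1 \<and> k = n))}"
        by (rule imageE)
      then show "\<exists>j\<in>{1..n}. \<exists>k\<in>{1..n}. \<sigma> = shift n j \<and> \<sigma>' = shift n k \<and>
        (j = k \<or> j = n \<or> (j = n - 1 \<and> k = n))"
        by (intro bexI[of _ "fst p"] bexI[of _ "snd p"]) (simp_all add: case_prod_beta)
    qed
    finally show ?thesis .
  qed
  then show ?thesis by (intro set_eqI) (simp only: split_paired_all)
qed

section \<open>Counting the index pairs\<close>

lemma card_avoiding_three_permutations:
  assumes "1 \<le> n"
  shows "card (avoiding_three_permutations n {[2, 1, 3], [2, 3, 1], [3, 2, 1]}) =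
    (if n = 1 then 1 else 2 * n)"
proof -
  let ?I = "{(j, k). j \<in> {1..n} \<and> k \<in> {1..n} \<and> (j = k \<or> j = n \<or> (j = n - 1 \<and> k = n))}"
  let ?D = "(\<lambda>j. (j, j)) ` {1..n}"
  \<comment> \<open>The pair (n, n) is left out because it lies on the diagonal
    \<open>?D\<close>.\<close>
  let ?E = "(\<lambda>k. (n, k)) ` {1..<n}"
  have "inj_on (\<lambda>(j, k). (shift n j, shift n k)) ?I"
    by (auto simp: inj_on_def shift_eq_iff)
  then have "card (avoiding_three_permutations n {[2, 1, 3], [2, 3, 1], [3, 2, 1]}) = card ?I"
    unfolding avoiding_three_permutations_eq[OF assms] by (rule card_image)
  also have "\<dots> = (if n = 1 then 1 else 2 * n)"
  proof (cases "n = 1")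
    case True
    then have "?I = {(1, 1)}" by auto
    then show ?thesis using True by simp
  next
    case False
    \<comment> \<open>Here n \<ge> 2, so the exceptional pair (n - 1, n) has indices in range and
      contributes one pair beyond \<open>?D\<close> and \<open>?E\<close>.\<close>
    then have "?I = insert (n - 1, n) (?D \<union> ?E)"
      using assms by (auto simp: image_iff)
    moreover have "card (?D \<union> ?E) = n + (n - 1)"
      by (subst card_Un_disjoint) (auto simp: card_image inj_on_def)
    moreover have "(n - 1, n) \<notin> ?D \<union> ?E" using False assms by auto
    ultimately show ?thesis using False assms by simp
  qed
  finally show ?thesis .
qed

theorem theorem4p4:
  fixes a :: "nat \<Rightarrow> nat"
  assumes a_def: "\<And>n. n \<ge> 1 \<Longrightarrow>
    a n = card (avoiding_three_permutations n {[2, 1, 3], [2, 3, 1], [3, 2, 1]})"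
  shows "a 1 = 1 \<and> (\<forall>n\<ge>1. a (n + 1) = 2 * (n + 1))"
  \<comment> \<open>For n \<ge> 1 the size n + 1 is not 1, so the second branch of the count
    applies.\<close>
  using card_avoiding_three_permutations by (simp add: a_def del: One_nat_def)

end
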